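(* Let $\widetilde{\mathcal M}$ be a smooth (at least $C^3$), closed, compact Riemannian surface. For any piecewise smooth curve $\gamma$ in $\widetilde{\mathcal M}$ and any smooth isometric embedding $F:\widetilde{\mathcal M}\hookrightarrow\mathbb R^N$ onto a surface $\mathcal M=F(\widetilde{\mathcal M})$ in a Euclidean space $\mathbb R^N$, setting $\mathbf c:=F\circ\gamma$ one has $$\mathrm{TC}_{\widetilde{\mathcal M}}(\gamma)=\mathrm{TC}_{\mathcal M}(\mathbf c),$$ independently of the chosen isometric embedding $F$.
   Context: Let $\mathcal N$ denote either the Riemannian surface $\widetilde{\mathcal M}$ or the surface $\mathcal M\subset\mathbb R^N$ with the metric induced by the Euclidean one. A polygonal in $\mathcal N$ is a finite concatenation of geodesic arcs of $\mathcal N$; its rotation $\mathbf k_{\mathcal N}(P)$ is the sum of the (non-negative) turning angles between consecutive geodesic arcs. $P$ is inscribed in a curve $\gamma:[a,b]\to\mathcal N$ if it is obtained by choosing $a\le t_0<t_1<\dots<t_n\le b$ and connecting the consecutive points $\gamma(t_i)$ by (length-minimizing) geodesic segments of $\mathcal N$. The modulus $\mu_\gamma(P)$ is the maximum of the geodesic diameters in $\mathcal N$ of the arcs of $\gamma$ determined by consecutive vertices of $P$. The total intrinsic curvature is $$\mathrm{TC}_{\mathcal N}(\gamma):=\lim_{\varepsilon\to0^+}\sup\{\mathbf k_{\mathcal N}(P)\mid P\text{ inscribed in }\gamma,\ \mu_\gamma(P)<\varepsilon\}.$$ *)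

theory Defs
  imports "HOL-Analysis.Analysis"
begin

text \<open>
  Class \<open>C\<^sup>n\<close> relative to a set. Derivatives are taken within \<open>S\<close>, so one definition serves
  open subsets of the plane and relatively open subsets of a nondegenerate compact interval
  (one-sided derivatives at its end points); these are the only sets it is used for, and
  on them the derivative is unique.
\<close>

primrec C_class :: "nat \<Rightarrow> 'a::real_normed_vector set \<Rightarrow> ('a \<Rightarrow> 'b::real_normed_vector) \<Rightarrow> bool" where
  "C_class 0 S f \<longleftrightarrow> continuous_on S f"
| "C_class (Suc n) S f \<longleftrightarrow>
     (\<exists>f'. (\<forall>x\<in>S. (f has_derivative f' x) (at x within S)) \<and> (\<forall>v. C_class n S (\<lambda>x. f' x v)))"

definition C_on :: "enat \<Rightarrow> 'a::real_normed_vector set \<Rightarrow> ('a \<Rightarrow> 'b::real_normed_vector) \<Rightarrow> bool" where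
  "C_on k S f \<longleftrightarrow> (\<forall>n. enat n \<le> k \<longrightarrow> C_class n S f)"


section \<open>Riemannian surfaces\<close>

text \<open>
  A chart is a domain together with a map; the values of the map off the domain are irrelevant.
  The metric is given by its local expressions: \<open>metric N c x\<close> is the bilinear form
  representing the metric in the chart \<open>c\<close> at the coordinate point \<open>x\<close>.
\<close>

type_synonym 'a chart = "'a set \<times> ('a \<Rightarrow> real^2)"

record 'a surface =
  points :: "'a set"
  charts :: "'a chart set"
  metric :: "'a chart \<Rightarrow> real^2 \<Rightarrow> real^2 \<Rightarrow> real^2 \<Rightarrow> real"

definition chart_inv :: "'a chart \<Rightarrow> real^2 \<Rightarrow> 'a" where
  "chart_inv c = inv_into (fst c) (snd c)"

definition chart_on :: "'a::topological_space set \<Rightarrow> 'a chart \<Rightarrow> bool" where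
  "chart_on S c \<longleftrightarrow>
     openin (top_of_set S) (fst c) \<and> open (snd c ` fst c) \<and>
     homeomorphism (fst c) (snd c ` fst c) (snd c) (chart_inv c)"

definition transition :: "'a chart \<Rightarrow> 'a chart \<Rightarrow> real^2 \<Rightarrow> real^2" where
  "transition c d = snd d \<circ> chart_inv c"

definition compatible :: "enat \<Rightarrow> 'a chart \<Rightarrow> 'a chart \<Rightarrow> bool" where
  "compatible k c d \<longleftrightarrow>
     C_on k (snd c ` (fst c \<inter> fst d)) (transition c d) \<and>
     C_on k (snd d ` (fst c \<inter> fst d)) (transition d c)"

definition maximal_atlas :: "enat \<Rightarrow> 'a::topological_space set \<Rightarrow> 'a chart set \<Rightarrow> bool" where
  "maximal_atlas k S A \<longleftrightarrow>
     (\<forall>c\<in>A. chart_on S c) \<and> S = (\<Union>c\<in>A. fst c) \<and>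
     (\<forall>c\<in>A. \<forall>d\<in>A. compatible k c d) \<and>
     (\<forall>c. chart_on S c \<and> (\<forall>d\<in>A. compatible k c d) \<longrightarrow> c \<in> A)"

definition inner_product :: "(real^2 \<Rightarrow> real^2 \<Rightarrow> real) \<Rightarrow> bool" where
  "inner_product B \<longleftrightarrow>
     bilinear B \<and> (\<forall>u v. B u v = B v u) \<and> (\<forall>u. u \<noteq> 0 \<longrightarrow> B u u > 0)"

text \<open>
  A surface of class \<open>C\<^sup>k\<close> without boundary. The metric is only asked to be of class
  \<open>C\<^sup>k\<^sup>-\<^sup>1\<close>, the regularity of a metric induced by a \<open>C\<^sup>k\<close> embedding
  (for \<open>k = \<infinity>\<close> both are smooth, as \<open>\<infinity> - 1 = \<infinity>\<close>).
\<close>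

definition riemannian_surface :: "enat \<Rightarrow> 'a::t2_space surface \<Rightarrow> bool" where
  "riemannian_surface k N \<longleftrightarrow>
     maximal_atlas k (points N) (charts N) \<and>
     (\<forall>c\<in>charts N.
        (\<forall>x\<in>snd c ` fst c. inner_product (metric N c x)) \<and>
        (\<forall>u v. C_on (k - 1) (snd c ` fst c) (\<lambda>x. metric N c x u v))) \<and>
     (\<forall>c\<in>charts N. \<forall>d\<in>charts N. \<forall>x\<in>snd c ` (fst c \<inter> fst d). \<forall>u v.
        metric N c x u v =
          metric N d (transition c d x)
            (frechet_derivative (transition c d) (at x) u)
            (frechet_derivative (transition c d) (at x) v))"

text \<open>
  The surface \<open>M\<close> in Euclidean space, with its inverse \<open>C\<^sup>k\<close> local parametrizations as charts
  and the first fundamental form as metric.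
\<close>

definition embedded_surface :: "enat \<Rightarrow> 'a::euclidean_space set \<Rightarrow> 'a surface" where
  "embedded_surface k M =
     \<lparr>points = M,
      charts = {c. chart_on M c \<and> C_on k (snd c ` fst c) (chart_inv c) \<and>
                   (\<forall>x\<in>snd c ` fst c. inj (frechet_derivative (chart_inv c) (at x)))},
      metric = (\<lambda>c x u v. frechet_derivative (chart_inv c) (at x) u
                            \<bullet> frechet_derivative (chart_inv c) (at x) v)\<rparr>"

definition isometric_embedding ::
    "enat \<Rightarrow> 'a::t2_space surface \<Rightarrow> ('a \<Rightarrow> 'b::euclidean_space) \<Rightarrow> bool" where
  "isometric_embedding k N F \<longleftrightarrow>
     (\<exists>G. homeomorphism (points N) (F ` points N) F G) \<and>
     (\<forall>c\<in>charts N.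
        C_on k (snd c ` fst c) (F \<circ> chart_inv c) \<and>
        (\<forall>x\<in>snd c ` fst c.
           inj (frechet_derivative (F \<circ> chart_inv c) (at x)) \<and>
           (\<forall>u v. frechet_derivative (F \<circ> chart_inv c) (at x) u
                    \<bullet> frechet_derivative (F \<circ> chart_inv c) (at x) v = metric N c x u v)))"


section \<open>Curves, length and distance\<close>

definition C_curve :: "enat \<Rightarrow> 'a::topological_space surface \<Rightarrow> real \<Rightarrow> real \<Rightarrow> (real \<Rightarrow> 'a) \<Rightarrow> bool" where
  "C_curve r N a b \<gamma> \<longleftrightarrow>
     (\<forall>c\<in>charts N. C_on r {t\<in>{a..b}. \<gamma> t \<in> fst c} (snd c \<circ> \<gamma>))"

definition piecewise_C_curve ::
    "enat \<Rightarrow> 'a::topological_space surface \<Rightarrow> real \<Rightarrow> real \<Rightarrow> (real \<Rightarrow> 'a) \<Rightarrow> bool" where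
  "piecewise_C_curve r N a b \<gamma> \<longleftrightarrow>
     continuous_on {a..b} \<gamma> \<and> \<gamma> ` {a..b} \<subseteq> points N \<and>
     (\<exists>ts. sorted_wrt (<) ts \<and> 2 \<le> length ts \<and> hd ts = a \<and> last ts = b \<and>
           (\<forall>i. Suc i < length ts \<longrightarrow> C_curve r N (ts ! i) (ts ! Suc i) \<gamma>))"

text \<open>
  The common value of a coordinate expression over all charts around \<open>p\<close>. It is applied to
  expressions that are chart independent by the chain rule and the transformation law of
  the metric; it is unspecified only for the speed at the finitely many corners of a curve,
  which do not affect the length.
\<close>

definition in_charts :: "'a surface \<Rightarrow> 'a \<Rightarrow> ('a chart \<Rightarrow> real) \<Rightarrow> real" where
  "in_charts N p f = (THE y. \<forall>c\<in>charts N. p \<in> fst c \<longrightarrow> y = f c)"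

definition velocity :: "'a chart \<Rightarrow> (real \<Rightarrow> 'a) \<Rightarrow> real \<Rightarrow> real^2" where
  "velocity c \<sigma> t = vector_derivative (snd c \<circ> \<sigma>) (at t within {0..1})"

definition speed :: "'a surface \<Rightarrow> (real \<Rightarrow> 'a) \<Rightarrow> real \<Rightarrow> real" where
  "speed N \<sigma> t =
     in_charts N (\<sigma> t)
       (\<lambda>c. sqrt (metric N c (snd c (\<sigma> t)) (velocity c \<sigma> t) (velocity c \<sigma> t)))"

definition curve_length :: "'a surface \<Rightarrow> (real \<Rightarrow> 'a) \<Rightarrow> real" where
  "curve_length N \<sigma> = integral {0..1} (speed N \<sigma>)"

text \<open>The distance between different components is \<open>\<infinity>\<close>.\<close>

definition geodesic_dist :: "'a::topological_space surface \<Rightarrow> 'a \<Rightarrow> 'a \<Rightarrow> ennreal" where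
  "geodesic_dist N p q =
     (INF \<sigma>\<in>{\<sigma>. piecewise_C_curve 1 N 0 1 \<sigma> \<and> \<sigma> 0 = p \<and> \<sigma> 1 = q}. ennreal (curve_length N \<sigma>))"

definition geodesic_diameter :: "'a::topological_space surface \<Rightarrow> 'a set \<Rightarrow> ennreal" where
  "geodesic_diameter N A = (SUP p\<in>A. SUP q\<in>A. geodesic_dist N p q)"


section \<open>Geodesics and polygonals\<close>

text \<open>Christoffel symbols of the first kind: the metric pairing of \<open>\<Gamma>(u, v)\<close> with \<open>w\<close>.\<close>

definition christoffel ::
    "'a surface \<Rightarrow> 'a chart \<Rightarrow> real^2 \<Rightarrow> real^2 \<Rightarrow> real^2 \<Rightarrow> real^2 \<Rightarrow> real" where
  "christoffel N c x u v w =
     (frechet_derivative (\<lambda>y. metric N c y v w) (at x) u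
      + frechet_derivative (\<lambda>y. metric N c y u w) (at x) v
      - frechet_derivative (\<lambda>y. metric N c y u v) (at x) w) / 2"

text \<open>
  Geodesic arcs are parametrized on \<open>[0, 1]\<close> and nonconstant. In the coordinates \<open>x\<close> of a chart
  the equation is \<open>x'' + \<Gamma>(x', x') = 0\<close>, with the index lowered by the metric.
\<close>

definition geodesic_arc :: "'a::topological_space surface \<Rightarrow> (real \<Rightarrow> 'a) \<Rightarrow> bool" where
  "geodesic_arc N \<sigma> \<longleftrightarrow>
     path \<sigma> \<and> path_image \<sigma> \<subseteq> points N \<and> \<not> \<sigma> constant_on {0..1} \<and>
     (\<forall>c\<in>charts N. \<exists>x' x''. \<forall>t\<in>{t\<in>{0..1}. \<sigma> t \<in> fst c}.
        (snd c \<circ> \<sigma> has_vector_derivative x' t) (at t within {t\<in>{0..1}. \<sigma> t \<in> fst c}) \<and>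
        (x' has_vector_derivative x'' t) (at t within {t\<in>{0..1}. \<sigma> t \<in> fst c}) \<and>
        (\<forall>w. metric N c (snd c (\<sigma> t)) (x'' t) w
              + christoffel N c (snd c (\<sigma> t)) (x' t) (x' t) w = 0))"

definition minimizing_geodesic :: "'a::topological_space surface \<Rightarrow> (real \<Rightarrow> 'a) \<Rightarrow> bool" where
  "minimizing_geodesic N \<sigma> \<longleftrightarrow>
     geodesic_arc N \<sigma> \<and> ennreal (curve_length N \<sigma>) = geodesic_dist N (\<sigma> 0) (\<sigma> 1)"

definition polygonal :: "'a::topological_space surface \<Rightarrow> (real \<Rightarrow> 'a) list \<Rightarrow> bool" where
  "polygonal N P \<longleftrightarrow>
     P \<noteq> [] \<and> (\<forall>\<sigma>\<in>set P. geodesic_arc N \<sigma>) \<and>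
     (\<forall>i. Suc i < length P \<longrightarrow> (P ! i) 1 = (P ! Suc i) 0)"

definition turning_angle :: "'a surface \<Rightarrow> (real \<Rightarrow> 'a) \<Rightarrow> (real \<Rightarrow> 'a) \<Rightarrow> real" where
  "turning_angle N \<sigma> \<tau> =
     in_charts N (\<sigma> 1)
       (\<lambda>c. let g = metric N c (snd c (\<sigma> 1)); u = velocity c \<sigma> 1; v = velocity c \<tau> 0
            in arccos (g u v / (sqrt (g u u) * sqrt (g v v))))"

definition rotation :: "'a surface \<Rightarrow> (real \<Rightarrow> 'a) list \<Rightarrow> real" where
  "rotation N P = (\<Sum>i<length P - 1. turning_angle N (P ! i) (P ! Suc i))"


section \<open>Total intrinsic curvature\<close>

text \<open>
  Geodesic arcs being nonconstant, consecutive vertices of an inscribed polygonal are distinct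
  points of the surface. As minimizing geodesics need not be unique, the parameters \<open>ts\<close>
  do not determine \<open>P\<close>.
\<close>

definition inscribed ::
    "'a::topological_space surface \<Rightarrow> real \<Rightarrow> real \<Rightarrow> (real \<Rightarrow> 'a) \<Rightarrow> real list \<Rightarrow> (real \<Rightarrow> 'a) list \<Rightarrow> bool" where
  "inscribed N a b \<gamma> ts P \<longleftrightarrow>
     polygonal N P \<and>
     sorted_wrt (<) ts \<and> set ts \<subseteq> {a..b} \<and> length ts = Suc (length P) \<and>
     (\<forall>i<length P. minimizing_geodesic N (P ! i) \<and>
                   (P ! i) 0 = \<gamma> (ts ! i) \<and> (P ! i) 1 = \<gamma> (ts ! Suc i))"

definition modulus :: "'a::topological_space surface \<Rightarrow> (real \<Rightarrow> 'a) \<Rightarrow> real list \<Rightarrow> ennreal" where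
  "modulus N \<gamma> ts = Max ((\<lambda>i. geodesic_diameter N (\<gamma> ` {ts ! i..ts ! Suc i})) ` {..<length ts - 1})"

text \<open>
  The supremum is monotone in \<open>\<epsilon>\<close>, so the limit exists in \<open>[0, \<infinity>]\<close>.
\<close>

definition total_intrinsic_curvature ::
    "'a::topological_space surface \<Rightarrow> real \<Rightarrow> real \<Rightarrow> (real \<Rightarrow> 'a) \<Rightarrow> ennreal" where
  "total_intrinsic_curvature N a b \<gamma> =
     Lim (at_right (0::real))
       (\<lambda>\<epsilon>. Sup {ennreal (rotation N P) | ts P.
                    inscribed N a b \<gamma> ts P \<and> modulus N \<gamma> ts < ennreal \<epsilon>})"

end

theory Submission
  imports Defs
begin

text \<open>
  Every ingredient of the total intrinsic curvature -- geodesics, length, distance, angles -- is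
  computed in charts from the metric, so it suffices that \<open>F\<close> matches the charts of \<open>N\<close> with those
  of the embedded surface so that the local expressions of the metric agree. A chart of \<open>N\<close> is
  pushed forward directly. Conversely, a chart of \<open>F(N)\<close> pulls back to a topological chart whose
  transition maps \<open>\<tau>\<close> to the atlas satisfy \<open>g \<circ> \<tau> = f\<close> with \<open>f\<close>, \<open>g\<close> of class \<open>C\<^sup>k\<close>, \<open>g\<close> an
  immersion and \<open>\<tau>\<close> continuous; hence \<open>\<tau>\<close> is \<open>C\<^sup>k\<close> and the chart lies in the atlas by maximality.
\<close>

section \<open>Calculus of class \<open>C\<^sup>n\<close>\<close>

lemma C_class_cong:
  assumes "C_class n S f" "\<And>x. x \<in> S \<Longrightarrow> g x = f x"
  shows "C_class n S g"
proof (cases n)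
  case 0
  then show ?thesis using assms continuous_on_cong[of S S g f] by simp
next
  case (Suc m)
  then show ?thesis using assms by (auto intro: has_derivative_transform)
qed

lemma C_on_cong:
  assumes "C_on k S f" "\<And>x. x \<in> S \<Longrightarrow> g x = f x"
  shows "C_on k S g"
  using assms unfolding C_on_def by (blast intro: C_class_cong)

lemma C_class_SucI:
  assumes "\<And>x. x \<in> S \<Longrightarrow> (f has_derivative f' x) (at x within S)" "\<And>v. C_class n S (\<lambda>x. f' x v)"
  shows "C_class (Suc n) S f"
  using assms by auto

lemma C_class_SucE:
  assumes "C_class (Suc n) S f"
  obtains f' where "\<And>x. x \<in> S \<Longrightarrow> (f has_derivative f' x) (at x within S)"
    "\<And>v. C_class n S (\<lambda>x. f' x v)"
  using assms by auto

lemma C_class_SucD: "C_class (Suc n) S f \<Longrightarrow> C_class n S f"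
proof (induction n arbitrary: f)
  case 0
  then show ?case by (auto intro: has_derivative_continuous_on)
next
  case (Suc n)
  then show ?case by (metis C_class.simps(2))
qed

lemma C_class_subset: "C_class n S f \<Longrightarrow> T \<subseteq> S \<Longrightarrow> C_class n T f"
proof (induction n arbitrary: f)
  case 0
  then show ?case using continuous_on_subset by auto
next
  case (Suc n)
  then show ?case by (auto intro: has_derivative_subset) (metis has_derivative_subset subsetD)
qed

lemma C_class_const: "C_class n S (\<lambda>x. c)"
  by (induction n arbitrary: c) (auto intro!: exI[of _ "\<lambda>x v. 0"])

lemma C_class_add:
  "C_class n S f \<Longrightarrow> C_class n S g \<Longrightarrow> C_class n S (\<lambda>x. f x + g x)"
proof (induction n arbitrary: f g)
  case 0
  then show ?case by (auto intro: continuous_intros)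
next
  case (Suc n)
  obtain f' where f': "\<And>x. x \<in> S \<Longrightarrow> (f has_derivative f' x) (at x within S)"
      "\<And>v. C_class n S (\<lambda>x. f' x v)"
    using Suc.prems(1) by (rule C_class_SucE) blast
  obtain g' where g': "\<And>x. x \<in> S \<Longrightarrow> (g has_derivative g' x) (at x within S)"
      "\<And>v. C_class n S (\<lambda>x. g' x v)"
    using Suc.prems(2) by (rule C_class_SucE) blast
  show ?case
    by (rule C_class_SucI[where f' = "\<lambda>x v. f' x v + g' x v"])
      (intro has_derivative_add f' g' Suc.IH; assumption)+
qed

lemma C_class_sum:
  "(\<And>i. i \<in> I \<Longrightarrow> C_class n S (f i)) \<Longrightarrow> C_class n S (\<lambda>x. \<Sum>i\<in>I. f i x)"
  by (induction I rule: infinite_finite_induct) (auto intro: C_class_const C_class_add)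

text \<open>By the product rule the derivative is a sum of products of the same form. The
  undifferentiated factors lose one class through \<open>C_class_SucD\<close>, so the induction
  hypothesis applies to both summands. One proof serves real products, scalar multiples and inner
  products.\<close>

lemma (in bounded_bilinear) C_class:
  "C_class n S f \<Longrightarrow> C_class n S g \<Longrightarrow> C_class n S (\<lambda>x. prod (f x) (g x))"
proof (induction n arbitrary: f g)
  case 0
  then show ?case by (auto intro: continuous_on)
next
  case (Suc n)
  obtain f' where f': "\<And>x. x \<in> S \<Longrightarrow> (f has_derivative f' x) (at x within S)"
      "\<And>v. C_class n S (\<lambda>x. f' x v)"
    using Suc.prems(1) by (rule C_class_SucE) blast
  obtain g' where g': "\<And>x. x \<in> S \<Longrightarrow> (g has_derivative g' x) (at x within S)"
      "\<And>v. C_class n S (\<lambda>x. g' x v)"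
    using Suc.prems(2) by (rule C_class_SucE) blast
  show ?case
  proof (rule C_class_SucI)
    show "((\<lambda>x. prod (f x) (g x)) has_derivative (\<lambda>v. prod (f x) (g' x v) + prod (f' x v) (g x)))
        (at x within S)" if "x \<in> S" for x
      by (rule FDERIV[OF f'(1) g'(1), OF that that])
    show "C_class n S (\<lambda>x. prod (f x) (g' x v) + prod (f' x v) (g x))" for v
      by (intro C_class_add Suc.IH f' g' C_class_SucD[OF Suc.prems(1)] C_class_SucD[OF Suc.prems(2)])
  qed
qed

lemmas C_class_mult = bounded_bilinear.C_class[OF bounded_bilinear_mult]
lemmas C_class_scaleR = bounded_bilinear.C_class[OF bounded_bilinear_scaleR]
lemmas C_class_inner = bounded_bilinear.C_class[OF bounded_bilinear_inner]

lemma C_class_minus: "C_class n S f \<Longrightarrow> C_class n S (\<lambda>x. - f x)"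
  using C_class_scaleR[OF C_class_const[of n S "-1"]] by simp

lemma C_class_diff:
  "C_class n S f \<Longrightarrow> C_class n S g \<Longrightarrow> C_class n S (\<lambda>x. f x - g x)"
  using C_class_add[OF _ C_class_minus] by fastforce

text \<open>The derivative of 1/f is a product of 1/f, f' and 1/f, so the induction hypothesis for
  1/f itself closes the step.\<close>

lemma C_class_inverse:
  fixes f :: "'a::real_normed_vector \<Rightarrow> real"
  assumes "\<And>x. x \<in> S \<Longrightarrow> f x \<noteq> 0"
  shows "C_class n S f \<Longrightarrow> C_class n S (\<lambda>x. inverse (f x))"
proof (induction n)
  case 0
  then show ?case using assms by (auto intro: continuous_intros)
next
  case (Suc n)
  obtain f' where f': "\<And>x. x \<in> S \<Longrightarrow> (f has_derivative f' x) (at x within S)"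
      "\<And>v. C_class n S (\<lambda>x. f' x v)"
    using Suc.prems by (rule C_class_SucE) blast
  show ?case
  proof (rule C_class_SucI)
    show "((\<lambda>x. inverse (f x)) has_derivative (\<lambda>v. - (inverse (f x) * f' x v * inverse (f x))))
        (at x within S)" if "x \<in> S" for x
      by (rule Deriv.has_derivative_inverse[OF assms f'(1), OF that that])
    show "C_class n S (\<lambda>x. - (inverse (f x) * f' x v * inverse (f x)))" for v
      by (intro C_class_minus C_class_mult f' Suc.IH C_class_SucD[OF Suc.prems])
  qed
qed

lemma C_class_divide:
  fixes f g :: "'a::real_normed_vector \<Rightarrow> real"
  assumes "C_class n S f" "C_class n S g" "\<And>x. x \<in> S \<Longrightarrow> g x \<noteq> 0"
  shows "C_class n S (\<lambda>x. f x / g x)"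
  using C_class_mult[OF assms(1) C_class_inverse[OF assms(3,2)]] by (simp add: divide_inverse)

lemma C_class_compose:
  fixes f :: "'a::real_normed_vector \<Rightarrow> 'b::euclidean_space"
  shows "C_class n T g \<Longrightarrow> C_class n S f \<Longrightarrow> f ` S \<subseteq> T \<Longrightarrow> C_class n S (\<lambda>x. g (f x))"
proof (induction n arbitrary: g)
  case 0
  then show ?case by (auto intro: continuous_on_compose2)
next
  case (Suc n)
  obtain f' where f': "\<And>x. x \<in> S \<Longrightarrow> (f has_derivative f' x) (at x within S)"
      "\<And>v. C_class n S (\<lambda>x. f' x v)"
    using Suc.prems(2) by (rule C_class_SucE) blast
  obtain g' where g': "\<And>y. y \<in> T \<Longrightarrow> (g has_derivative g' y) (at y within T)"
      "\<And>v. C_class n T (\<lambda>x. g' x v)"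
    using Suc.prems(1) by (rule C_class_SucE) blast
  have D: "((\<lambda>x. g (f x)) has_derivative (\<lambda>v. g' (f x) (f' x v))) (at x within S)" if "x \<in> S" for x
  proof -
    have "(g has_derivative g' (f x)) (at (f x) within f ` S)"
      using g' Suc.prems that has_derivative_subset by blast
    then show ?thesis
      using diff_chain_within[of f "f' x" x S g "g' (f x)"] f' that by (simp add: o_def)
  qed
  \<comment> \<open>\<open>C_class\<close> controls g' only at fixed vectors, while here the
    direction f' x v moves with x. Expanding it in the finite basis leaves fixed directions b with
    scalar coefficients of class C^n.\<close>
  have "C_class n S (\<lambda>x. g' (f x) (f' x v))" for v
  proof (rule C_class_cong)
    show "C_class n S (\<lambda>x. \<Sum>b\<in>Basis. (f' x v \<bullet> b) *\<^sub>R g' (f x) b)"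
      by (intro C_class_sum C_class_scaleR C_class_inner f' C_class_const Suc.IH g'
          C_class_SucD[OF Suc.prems(2)] Suc.prems(3))
    fix x assume "x \<in> S"
    with Suc.prems(3) have "f x \<in> T" by blast
    note lin = has_derivative_linear[OF g'(1)[OF this]]
    have "g' (f x) (f' x v) = g' (f x) (\<Sum>b\<in>Basis. (f' x v \<bullet> b) *\<^sub>R b)"
      by (simp add: euclidean_representation)
    then show "g' (f x) (f' x v) = (\<Sum>b\<in>Basis. (f' x v \<bullet> b) *\<^sub>R g' (f x) b)"
      by (simp only: linear_sum[OF lin] linear_scale[OF lin])
  qed
  with D show ?case by (rule C_class_SucI)
qed

section \<open>Lifting through an immersion\<close>

text \<open>Since P inverts A on the left, the increment of \<open>\<tau>\<close> equals P applied
  to A of that increment, and A of it is the increment of f up to the remainder of g. That remainder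
  is small relative to the increment of \<open>\<tau>\<close>, so a Lipschitz bound for
  \<open>\<tau>\<close> at x is needed first.\<close>

lemma has_derivative_lift:
  assumes g: "(g has_derivative A) (at (\<tau> x) within T)" and "\<tau> ` S \<subseteq> T"
    and f: "(f has_derivative B) (at x within S)" and "x \<in> S"
    and eq: "\<And>z. z \<in> S \<Longrightarrow> g (\<tau> z) = f z"
    and \<tau>: "continuous (at x within S) \<tau>"
    and P: "bounded_linear P" "\<And>w. P (A w) = w"
  shows "(\<tau> has_derivative (\<lambda>v. P (B v))) (at x within S)"
proof -
  interpret A: bounded_linear A using g has_derivative_bounded_linear by blast
  interpret B: bounded_linear B using f has_derivative_bounded_linear by blast
  interpret P: bounded_linear P by fact
  obtain K where K: "K > 0" "\<And>w. norm (P w) \<le> K * norm w"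
    using P.pos_bounded by (metis mult.commute)
  obtain L where L: "L > 0" "\<And>w. norm (B w) \<le> L * norm w"
    using B.pos_bounded by (metis mult.commute)
  \<comment> \<open>Continuity of \<open>\<tau>\<close> brings \<open>\<tau> z\<close> into the
    neighbourhood of \<open>\<tau> x\<close> on which the first-order estimate for g holds.\<close>
  have rem_g: "\<forall>\<^sub>F z in at x within S. norm (f z - f x - A (\<tau> z - \<tau> x)) \<le> e * norm (\<tau> z - \<tau> x)"
    if e: "e > 0" for e
  proof -
    obtain d where d: "d > 0" "\<And>y. y \<in> T \<Longrightarrow> norm (y - \<tau> x) < d \<Longrightarrow>
        norm (g y - g (\<tau> x) - A (y - \<tau> x)) \<le> e * norm (y - \<tau> x)"
      using g e unfolding has_derivative_within_alt by blast
    have "\<forall>\<^sub>F z in at x within S. dist (\<tau> z) (\<tau> x) < d"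
      using \<tau> d(1) unfolding continuous_within by (rule tendstoD)
    moreover have "\<forall>\<^sub>F z in at x within S. z \<in> S"
      by (simp add: eventually_at_filter)
    ultimately show ?thesis
    proof eventually_elim
      case (elim z)
      with assms(2) have "\<tau> z \<in> T" by blast
      from d(2)[OF this] elim show ?case
        by (simp add: dist_norm eq \<open>x \<in> S\<close>)
    qed
  qed
  have rem_f: "\<forall>\<^sub>F z in at x within S. norm (f z - f x - B (z - x)) \<le> e * norm (z - x)"
    if "e > 0" for e
    using f that unfolding has_derivative_within_alt2 by blast
  have split: "\<tau> z - \<tau> x - P (B (z - x)) =
      P (f z - f x - B (z - x)) - P (f z - f x - A (\<tau> z - \<tau> x))" for z
    by (simp add: P.diff P(2))
  \<comment> \<open>With this tolerance K times the remainder of g is at most half the increment of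
    \<open>\<tau>\<close> and can be absorbed into the left-hand side. The factor L + 1 below is the
    bound of B plus the remainder of f at tolerance 1.\<close>
  have half: "1 / (2 * K) > 0" using K by simp
  have lip: "\<forall>\<^sub>F z in at x within S. norm (\<tau> z - \<tau> x) \<le> 2 * K * (L + 1) * norm (z - x)"
    using rem_g[OF half] rem_f[OF zero_less_one]
  proof eventually_elim
    case (elim z)
    have "norm (f z - f x) \<le> norm (B (z - x)) + norm (f z - f x - B (z - x))"
      using norm_triangle_ineq[of "B (z - x)" "f z - f x - B (z - x)"] by simp
    also have "\<dots> \<le> (L + 1) * norm (z - x)"
      using L(2)[of "z - x"] elim(2) by (simp add: algebra_simps)
    finally have 1: "norm (f z - f x) \<le> (L + 1) * norm (z - x)" .
    have "\<tau> z - \<tau> x = P (f z - f x) - P (f z - f x - A (\<tau> z - \<tau> x))"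
      by (simp add: P.diff P(2))
    then have "norm (\<tau> z - \<tau> x) \<le> norm (P (f z - f x)) + norm (P (f z - f x - A (\<tau> z - \<tau> x)))"
      by (metis norm_triangle_ineq4)
    also have "\<dots> \<le> K * norm (f z - f x) + K * norm (f z - f x - A (\<tau> z - \<tau> x))"
      by (intro add_mono K(2))
    also have "\<dots> \<le> K * ((L + 1) * norm (z - x)) + K * (1 / (2 * K) * norm (\<tau> z - \<tau> x))"
      by (intro add_mono mult_left_mono 1 elim(1)) (use K(1) in auto)
    finally show ?case using K(1) by (simp add: field_simps)
  qed
  have "\<forall>\<^sub>F z in at x within S. norm (\<tau> z - \<tau> x - P (B (z - x))) \<le> e * norm (z - x)"
    if e: "e > 0" for e
  proof -
    define C where "C = 2 * K * (L + 1)"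
    have C: "C > 0" using K L by (simp add: C_def)
    \<comment> \<open>The tolerances are chosen so that, after multiplication by K and use of the
      Lipschitz constant C, each remainder contributes half of e.\<close>
    have "e / (2 * K) > 0" "e / (2 * K * C) > 0" using e K C by auto
    from rem_f[OF this(1)] rem_g[OF this(2)] lip show ?thesis
      unfolding C_def[symmetric]
    proof eventually_elim
      case (elim z)
      have "norm (\<tau> z - \<tau> x - P (B (z - x))) \<le>
          norm (P (f z - f x - B (z - x))) + norm (P (f z - f x - A (\<tau> z - \<tau> x)))"
        unfolding split by (rule norm_triangle_ineq4)
      also have "\<dots> \<le> K * norm (f z - f x - B (z - x)) + K * norm (f z - f x - A (\<tau> z - \<tau> x))"
        by (intro add_mono K(2))
      also have "\<dots> \<le> K * (e / (2 * K) * norm (z - x)) + K * (e / (2 * K * C) * (C * norm (z - x)))"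
        using K(1) C e
        by (intro add_mono mult_left_mono elim(1) order_trans[OF elim(2)] elim(3)) auto
      also have "\<dots> = e * norm (z - x)" using K(1) C by (simp add: field_simps)
      finally show ?case .
    qed
  qed
  then show ?thesis
    unfolding has_derivative_within_alt2
    using bounded_linear_compose[OF P(1) B.bounded_linear_axioms] by blast
qed

text \<open>
  The pseudoinverse \<open>(A\<^sup>T A)\<inverse> A\<^sup>T\<close> of the linear map \<open>A\<close> with columns \<open>p\<close> and \<open>q\<close>, by Cramer's rule.
\<close>

definition gram_inverse :: "'a::real_inner \<Rightarrow> 'a \<Rightarrow> 'a \<Rightarrow> real^2" where
  "gram_inverse p q z =
     (((q \<bullet> q) * (z \<bullet> p) - (p \<bullet> q) * (z \<bullet> q)) / ((p \<bullet> p) * (q \<bullet> q) - (p \<bullet> q) * (p \<bullet> q))) *\<^sub>R axis 1 1 +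
     (((p \<bullet> p) * (z \<bullet> q) - (p \<bullet> q) * (z \<bullet> p)) / ((p \<bullet> p) * (q \<bullet> q) - (p \<bullet> q) * (p \<bullet> q))) *\<^sub>R axis 2 1"

text \<open>A zero determinant is equality in Cauchy-Schwarz: the part of q orthogonal to p, scaled
  by \<open>p \<bullet> p\<close>, has squared norm \<open>p \<bullet> p\<close> times the
  determinant and so vanishes. This is a linear relation between the columns, which injectivity
  forbids.\<close>

lemma gram_det_nonzero:
  fixes A :: "real^2 \<Rightarrow> 'a::real_inner"
  assumes "linear A" "inj A"
  defines "p \<equiv> A (axis 1 1)" and "q \<equiv> A (axis 2 1)"
  shows "(p \<bullet> p) * (q \<bullet> q) - (p \<bullet> q) * (p \<bullet> q) \<noteq> 0"
proof
  assume D: "(p \<bullet> p) * (q \<bullet> q) - (p \<bullet> q) * (p \<bullet> q) = 0"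
  interpret linear A by fact
  define r where "r = (p \<bullet> p) *\<^sub>R q - (p \<bullet> q) *\<^sub>R p"
  have "r \<bullet> r = (p \<bullet> p) * ((p \<bullet> p) * (q \<bullet> q) - (p \<bullet> q) * (p \<bullet> q))"
    unfolding r_def by (simp add: inner_diff inner_commute algebra_simps)
  then have "A ((p \<bullet> p) *\<^sub>R axis 2 1 - (p \<bullet> q) *\<^sub>R axis 1 1) = 0"
    using D by (simp add: diff scale p_def q_def r_def)
  then have "(p \<bullet> p) *\<^sub>R axis 2 1 - (p \<bullet> q) *\<^sub>R axis 1 1 = (0 :: real^2)"
    using \<open>inj A\<close> by (metis injD zero)
  \<comment> \<open>The second coordinate of the vanishing vector is \<open>p \<bullet> p\<close>,
    so p = 0, contradicting injectivity once more.\<close>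
  then have "((p \<bullet> p) *\<^sub>R axis 2 1 - (p \<bullet> q) *\<^sub>R axis 1 1 :: real^2) $ 2 = 0"
    by (simp only: zero_index)
  then have "p = 0" by (simp add: axis_def)
  then have "axis 1 1 = (0 :: real^2)"
    using \<open>inj A\<close> unfolding p_def by (metis injD zero)
  then show False by simp
qed

text \<open>For z = A w the two numerators are the coordinates of w times the Gram determinant,
  which cancels because it is nonzero.\<close>

lemma gram_inverse:
  fixes A :: "real^2 \<Rightarrow> 'a::real_inner"
  assumes "linear A" "inj A"
  shows "gram_inverse (A (axis 1 1)) (A (axis 2 1)) (A w) = w"
proof -
  interpret linear A by fact
  let ?p = "A (axis 1 1)" and ?q = "A (axis 2 1)"
  have w: "w = w $ 1 *\<^sub>R axis 1 1 + w $ 2 *\<^sub>R axis 2 1"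
    by (simp add: vec_eq_iff forall_2 axis_def)
  have Aw: "A w = w $ 1 *\<^sub>R ?p + w $ 2 *\<^sub>R ?q"
    by (subst w) (simp only: add scale)
  have "gram_inverse ?p ?q (A w) = w $ 1 *\<^sub>R axis 1 1 + w $ 2 *\<^sub>R axis 2 1"
    unfolding gram_inverse_def Aw using gram_det_nonzero[OF assms]
    by (intro arg_cong2[where f = "(+)"] arg_cong2[where f = scaleR] refl)
       (simp_all add: divide_eq_eq inner_add inner_commute algebra_simps)
  with w show ?thesis by simp
qed

lemma bounded_linear_gram_inverse: "bounded_linear (gram_inverse p q)"
  unfolding gram_inverse_def
  by (intro bounded_linear_add bounded_linear_scaleR_left[THEN bounded_linear_compose]
      bounded_linear_divide[THEN bounded_linear_compose] bounded_linear_sub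
      bounded_linear_mult_right[THEN bounded_linear_compose] bounded_linear_inner_left)

text \<open>The reason for an explicit left inverse: it is rational in inner products, hence as
  regular in the varying columns as in the vector it acts on.\<close>

lemma C_class_gram_inverse:
  assumes "C_class n S p" "C_class n S q" "C_class n S z"
    "\<And>x. x \<in> S \<Longrightarrow> (p x \<bullet> p x) * (q x \<bullet> q x) - (p x \<bullet> q x) * (p x \<bullet> q x) \<noteq> 0"
  shows "C_class n S (\<lambda>x. gram_inverse (p x) (q x) (z x))"
  unfolding gram_inverse_def
  by (intro C_class_add C_class_scaleR C_class_divide C_class_diff C_class_mult C_class_inner
      C_class_const assms)

text \<open>
  Bootstrapping: \<open>D\<tau> = (Dg \<circ> \<tau>)\<^sup>+ Df\<close> is at least as regular as \<open>\<tau>\<close>, so \<open>\<tau>\<close> gains one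
  derivative each time.
\<close>

lemma C_class_lift:
  fixes g :: "real^2 \<Rightarrow> 'b::real_inner"
  assumes T: "open T" and \<tau>: "\<tau> ` S \<subseteq> T" "continuous_on S \<tau>"
    and inj: "\<And>y. y \<in> T \<Longrightarrow> inj (frechet_derivative g (at y))"
    and eq: "\<And>z. z \<in> S \<Longrightarrow> g (\<tau> z) = f z"
  shows "C_class n S f \<Longrightarrow> C_class n T g \<Longrightarrow> C_class n S \<tau>"
proof (induction n)
  case 0
  then show ?case using \<tau> by simp
next
  case (Suc n)
  obtain f' where f': "\<And>x. x \<in> S \<Longrightarrow> (f has_derivative f' x) (at x within S)"
      "\<And>v. C_class n S (\<lambda>x. f' x v)"
    using Suc.prems(1) by (rule C_class_SucE) blast
  obtain g' where g': "\<And>y. y \<in> T \<Longrightarrow> (g has_derivative g' y) (at y within T)"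
      "\<And>v. C_class n T (\<lambda>x. g' x v)"
    using Suc.prems(2) by (rule C_class_SucE) blast
  have n: "C_class n S \<tau>" by (rule Suc.IH[OF Suc.prems[THEN C_class_SucD]])
  \<comment> \<open>As T is open, the derivative within T is the full derivative, to which the
    injectivity hypothesis refers.\<close>
  have lin: "linear (g' y)" and inj': "inj (g' y)" if "y \<in> T" for y
    using inj[OF that] g'(1)[OF that] frechet_derivative_at[of g "g' y" y] has_derivative_linear
      at_within_open[OF that T] by auto
  show ?case
  proof (rule C_class_SucI)
    fix x assume x: "x \<in> S"
    then have \<tau>x: "\<tau> x \<in> T" using \<tau> by blast
    have "continuous (at x within S) \<tau>"
      using \<tau>(2) x by (simp add: continuous_on_eq_continuous_within)
    then show "(\<tau> has_derivative
        (\<lambda>v. gram_inverse (g' (\<tau> x) (axis 1 1)) (g' (\<tau> x) (axis 2 1)) (f' x v))) (at x within S)"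
      by (intro has_derivative_lift[OF g'(1)[OF \<tau>x] \<tau>(1) f'(1)[OF x] x eq] 
          bounded_linear_gram_inverse gram_inverse lin[OF \<tau>x] inj'[OF \<tau>x])
  next
    fix v
    show "C_class n S (\<lambda>x. gram_inverse (g' (\<tau> x) (axis 1 1)) (g' (\<tau> x) (axis 2 1)) (f' x v))"
      by (intro C_class_gram_inverse C_class_compose[OF g'(2) n \<tau>(1)] f' gram_det_nonzero lin inj')
        (use \<tau>(1) in auto)
  qed
qed

section \<open>Invariance under correspondence of charts\<close>

text \<open>\<open>frechet_derivative\<close> is a choice among the admissible derivatives. Both
  functions admit the same ones, so the choices agree even if there are none.\<close>

lemma frechet_derivative_cong_open:
  assumes "open S" "x \<in> S" "\<And>y. y \<in> S \<Longrightarrow> f y = g y"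
  shows "frechet_derivative f (at x) = frechet_derivative g (at x)"
proof -
  have "(f has_derivative D) (at x) \<longleftrightarrow> (g has_derivative D) (at x)" for D
    using assms has_derivative_transform_within_open[of f D x UNIV S g]
      has_derivative_transform_within_open[of g D x UNIV S f] by auto
  then show ?thesis unfolding frechet_derivative_def by simp
qed

lemma has_vector_derivative_within_cong:
  assumes "x \<in> S" "\<And>y. y \<in> S \<Longrightarrow> f y = g y"
  shows "(f has_vector_derivative D) (at x within S) \<longleftrightarrow> (g has_vector_derivative D) (at x within S)"
  using assms has_derivative_transform[of x S f g] has_derivative_transform[of x S g f]
  unfolding has_vector_derivative_def by metis

text \<open>In such a pair of charts \<open>F\<close> reads as the identity of a common coordinate
  domain, so coordinate formulas on both sides can be compared at the same point of the
  plane.\<close>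

definition corresponding_charts ::
    "'a surface \<Rightarrow> 'b surface \<Rightarrow> ('a \<Rightarrow> 'b) \<Rightarrow> 'a chart \<Rightarrow> 'b chart \<Rightarrow> bool" where
  "corresponding_charts N M F c d \<longleftrightarrow>
     c \<in> charts N \<and> d \<in> charts M \<and> fst d = F ` fst c \<and> (\<forall>p\<in>fst c. snd d (F p) = snd c p) \<and>
     (\<forall>x\<in>snd c ` fst c. metric N c x = metric M d x)"

lemma constant_on_iff: "a \<in> S \<Longrightarrow> f constant_on S \<longleftrightarrow> (\<forall>x\<in>S. f x = f a)"
  unfolding constant_on_def by metis

text \<open>\<open>push_chart\<close> and \<open>pull_chart\<close> make the correspondence total on
  both sides. Both are needed because the notions to be compared quantify over all charts of their
  surface.\<close>

locale surface_isometry =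
  fixes N :: "'a::topological_space surface" and M :: "'b::topological_space surface"
    and F :: "'a \<Rightarrow> 'b" and G :: "'b \<Rightarrow> 'a"
  assumes homeo: "homeomorphism (points N) (points M) F G"
    and chart_on: "c \<in> charts N \<Longrightarrow> chart_on (points N) c"
    and push_chart: "c \<in> charts N \<Longrightarrow> \<exists>d. corresponding_charts N M F c d"
    and pull_chart: "d \<in> charts M \<Longrightarrow> \<exists>c. corresponding_charts N M F c d"
begin

section \<open>Transfer of chart expressions\<close>

abbreviation corresponding :: "'a chart \<Rightarrow> 'b chart \<Rightarrow> bool" where
  "corresponding \<equiv> corresponding_charts N M F"

lemmas corresponding_def = corresponding_charts_def[of N M F]

lemma inj_on_points: "inj_on F (points N)"
  using homeo by (metis homeomorphism_def inj_on_inverseI)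

lemma chart_subset: "corresponding c d \<Longrightarrow> fst c \<subseteq> points N"
  unfolding corresponding_def using chart_on chart_on_def openin_imp_subset by blast

lemma mem_chart: "corresponding c d \<Longrightarrow> p \<in> points N \<Longrightarrow> F p \<in> fst d \<longleftrightarrow> p \<in> fst c"
  using inj_on_image_mem_iff[OF inj_on_points _ chart_subset, of p c d]
  unfolding corresponding_def by simp

lemma metric_eq: "corresponding c d \<Longrightarrow> x \<in> snd c ` fst c \<Longrightarrow> metric N c x = metric M d x"
  unfolding corresponding_def by blast

lemma chart_eq: "corresponding c d \<Longrightarrow> p \<in> fst c \<Longrightarrow> snd d (F p) = snd c p"
  unfolding corresponding_def by simp

text \<open>The transfer principle behind the invariance results: every chart has a partner, so a
  property invariant under correspondence holds for all charts on one side exactly when it does on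
  the other.\<close>

lemma all_charts_iff:
  assumes "\<And>c d. corresponding c d \<Longrightarrow> P c \<longleftrightarrow> Q d"
  shows "(\<forall>c\<in>charts N. P c) \<longleftrightarrow> (\<forall>d\<in>charts M. Q d)"
  using assms push_chart pull_chart unfolding corresponding_def by meson

text \<open>The defining predicates of the two descriptions agree for every y. Hence the values
  agree also where no unique y exists, as may happen for the speed at a corner.\<close>

lemma in_charts_eq:
  assumes "p \<in> points N" "\<And>c d. corresponding c d \<Longrightarrow> p \<in> fst c \<Longrightarrow> f c = g d"
  shows "in_charts N p f = in_charts M (F p) g"
proof -
  have "(\<forall>c\<in>charts N. p \<in> fst c \<longrightarrow> y = f c) \<longleftrightarrow> (\<forall>d\<in>charts M. F p \<in> fst d \<longrightarrow> y = g d)" for y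
    using assms mem_chart by (intro all_charts_iff) auto
  then show ?thesis unfolding in_charts_def by simp
qed

text \<open>Derivatives of the metric enter, so equality at the point x alone would not do; the
  metrics agree on the whole open coordinate domain.\<close>

lemma christoffel_eq:
  assumes "corresponding c d" "x \<in> snd c ` fst c"
  shows "christoffel N c x = christoffel M d x"
proof -
  have "open (snd c ` fst c)"
    using assms(1) chart_on unfolding corresponding_def chart_on_def by blast
  then have "frechet_derivative (\<lambda>y. metric N c y v w) (at x) =
      frechet_derivative (\<lambda>y. metric M d y v w) (at x)" for v w
    by (rule frechet_derivative_cong_open[OF _ assms(2)]) (simp add: metric_eq[OF assms(1)])
  then show ?thesis unfolding christoffel_def by simp
qed

text \<open>
  Curves are functions on the whole line, but only their values on \<open>[0, 1]\<close> matter; a relation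
  avoids choosing values elsewhere.
\<close>

definition lifts :: "(real \<Rightarrow> 'a) \<Rightarrow> (real \<Rightarrow> 'b) \<Rightarrow> bool" where
  "lifts \<sigma> \<tau> \<longleftrightarrow> (\<forall>t\<in>{0..1}. \<sigma> t \<in> points N \<and> \<tau> t = F (\<sigma> t))"

lemma lifts_push: "\<sigma> ` {0..1} \<subseteq> points N \<Longrightarrow> lifts \<sigma> (F \<circ> \<sigma>)"
  unfolding lifts_def by auto

lemma lifts_pull: "\<tau> ` {0..1} \<subseteq> points M \<Longrightarrow> lifts (G \<circ> \<tau>) \<tau>"
  using homeo unfolding lifts_def homeomorphism_def by fastforce

lemma lifts_subset:
  assumes "lifts \<sigma> \<tau>" shows "\<sigma> ` {0..1} \<subseteq> points N" "\<tau> ` {0..1} \<subseteq> points M"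
  using assms homeo unfolding lifts_def homeomorphism_def by auto

lemma lifts_continuous_on:
  assumes "lifts \<sigma> \<tau>"
  shows "continuous_on {0..1} \<sigma> \<longleftrightarrow> continuous_on {0..1} \<tau>"
proof
  have F: "continuous_on (points N) F" and G: "continuous_on (points M) G"
    and GF: "\<And>p. p \<in> points N \<Longrightarrow> G (F p) = p"
    using homeo unfolding homeomorphism_def by auto
  show "continuous_on {0..1} \<tau>" if "continuous_on {0..1} \<sigma>"
  proof -
    have "continuous_on {0..1} (\<lambda>t. F (\<sigma> t))"
      by (rule continuous_on_compose2[OF F that lifts_subset(1)[OF assms]])
    then show ?thesis
      by (rule continuous_on_eq) (use assms in \<open>auto simp: lifts_def\<close>)
  qed
  show "continuous_on {0..1} \<sigma>" if "continuous_on {0..1} \<tau>"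
  proof -
    have "continuous_on {0..1} (\<lambda>t. G (\<tau> t))"
      by (rule continuous_on_compose2[OF G that lifts_subset(2)[OF assms]])
    then show ?thesis
      by (rule continuous_on_eq) (use assms GF in \<open>auto simp: lifts_def\<close>)
  qed
qed

text \<open>A velocity depends only on the curve near t within [0, 1]. By continuity the curve stays
  in the chart domain there, and on that domain the two coordinate expressions coincide.\<close>

lemma velocity_eq:
  assumes "lifts \<sigma> \<tau>" "continuous_on {0..1} \<sigma>" "t \<in> {0..1}" "corresponding c d" "\<sigma> t \<in> fst c"
  shows "velocity c \<sigma> t = velocity d \<tau> t"
proof -
  obtain U where U: "open U" "fst c = points N \<inter> U"
  proof -
    have "openin (top_of_set (points N)) (fst c)"
      using assms(4) chart_on by (simp add: corresponding_def chart_on_def)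
    then show ?thesis using that by (auto simp: openin_open)
  qed
  obtain W where W: "open W" "W \<inter> {0..1} = \<sigma> -` U \<inter> {0..1}"
    using assms(2) U(1) by (auto simp: continuous_on_open_invariant)
  have "s \<in> {0..1} \<longrightarrow> (snd c \<circ> \<sigma>) s = (snd d \<circ> \<tau>) s" if "s \<in> W" for s
  proof
    assume s: "s \<in> {0..1}"
    then have "\<sigma> s \<in> fst c" using U W that assms(1) by (auto simp: lifts_def)
    then show "(snd c \<circ> \<sigma>) s = (snd d \<circ> \<tau>) s"
      using assms(1,4) s by (simp add: lifts_def chart_eq)
  qed
  moreover have "t \<in> W" using W U assms(3,5) by auto
  ultimately have "\<forall>\<^sub>F s in nhds t. s \<in> {0..1} \<longrightarrow> (snd c \<circ> \<sigma>) s = (snd d \<circ> \<tau>) s"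
    using W(1) unfolding eventually_nhds by blast
  then show ?thesis
    unfolding velocity_def by (rule vector_derivative_cong_eq) (use assms(3) in auto)
qed

lemma curve_length_eq:
  assumes "lifts \<sigma> \<tau>" "continuous_on {0..1} \<sigma>"
  shows "curve_length N \<sigma> = curve_length M \<tau>"
  unfolding curve_length_def
proof (rule integral_cong)
  fix t :: real assume t: "t \<in> {0..1}"
  then have \<tau>: "\<tau> t = F (\<sigma> t)" and p: "\<sigma> t \<in> points N" using assms(1) by (auto simp: lifts_def)
  show "speed N \<sigma> t = speed M \<tau> t"
    unfolding speed_def \<tau>
    by (rule in_charts_eq[OF p]) (simp add: velocity_eq[OF assms t] chart_eq metric_eq)
qed

text \<open>The hypothesis that the arcs meet ensures that a chart around the end of the first arc
  also contains the start of the second, so both velocities transfer in it.\<close>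

lemma turning_angle_eq:
  assumes "lifts \<sigma> \<sigma>'" "continuous_on {0..1} \<sigma>" "lifts \<tau> \<tau>'" "continuous_on {0..1} \<tau>" "\<sigma> 1 = \<tau> 0"
  shows "turning_angle N \<sigma> \<tau> = turning_angle M \<sigma>' \<tau>'"
proof -
  have \<sigma>: "\<sigma>' 1 = F (\<sigma> 1)" and p: "\<sigma> 1 \<in> points N" using assms(1) by (auto simp: lifts_def)
  show ?thesis
    unfolding turning_angle_def \<sigma>
  proof (rule in_charts_eq[OF p])
    fix c d assume cd: "corresponding c d" and m: "\<sigma> 1 \<in> fst c"
    have "velocity c \<sigma> 1 = velocity d \<sigma>' 1" "velocity c \<tau> 0 = velocity d \<tau>' 0"
      using velocity_eq[OF assms(1,2) _ cd] velocity_eq[OF assms(3,4) _ cd] m assms(5) by auto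
    then show "(let g = metric N c (snd c (\<sigma> 1)); u = velocity c \<sigma> 1; v = velocity c \<tau> 0
            in arccos (g u v / (sqrt (g u u) * sqrt (g v v)))) =
        (let g = metric M d (snd d (F (\<sigma> 1))); u = velocity d \<sigma>' 1; v = velocity d \<tau>' 0
            in arccos (g u v / (sqrt (g u u) * sqrt (g v v))))"
      using cd m by (simp add: chart_eq metric_eq)
  qed
qed

section \<open>Regularity of curves, distance and geodesics\<close>

lemma lifts_preimage:
  assumes "lifts \<sigma> \<tau>" "corresponding c d" "T \<subseteq> {0..1}"
  shows "{t\<in>T. \<tau> t \<in> fst d} = {t\<in>T. \<sigma> t \<in> fst c}"
  using assms(1,3) mem_chart[OF assms(2)] by (auto simp: lifts_def subset_iff)

lemma lifts_coordinates:
  assumes "lifts \<sigma> \<tau>" "corresponding c d" "t \<in> {0..1}" "\<sigma> t \<in> fst c"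
  shows "(snd d \<circ> \<tau>) t = (snd c \<circ> \<sigma>) t"
  using assms chart_eq by (simp add: lifts_def)

lemma C_curve_iff:
  assumes "lifts \<sigma> \<tau>" "{s..t} \<subseteq> {0..1}"
  shows "C_curve r N s t \<sigma> \<longleftrightarrow> C_curve r M s t \<tau>"
  unfolding C_curve_def
proof (rule all_charts_iff)
  fix c d assume cd: "corresponding c d"
  have "(snd d \<circ> \<tau>) u = (snd c \<circ> \<sigma>) u" if "u \<in> {u\<in>{s..t}. \<sigma> u \<in> fst c}" for u
    using lifts_coordinates[OF assms(1) cd] that assms(2) by blast
  then show "C_on r {u\<in>{s..t}. \<sigma> u \<in> fst c} (snd c \<circ> \<sigma>) \<longleftrightarrow>
      C_on r {u\<in>{s..t}. \<tau> u \<in> fst d} (snd d \<circ> \<tau>)"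
    unfolding lifts_preimage[OF assms(1) cd assms(2)] by (metis (no_types, lifting) C_on_cong)
qed

lemma piecewise_C_curve_iff:
  assumes "lifts \<sigma> \<tau>"
  shows "piecewise_C_curve r N 0 1 \<sigma> \<longleftrightarrow> piecewise_C_curve r M 0 1 \<tau>"
proof -
  have "C_curve r N (ts ! i) (ts ! Suc i) \<sigma> \<longleftrightarrow> C_curve r M (ts ! i) (ts ! Suc i) \<tau>"
    if ts: "sorted_wrt (<) ts" "hd ts = 0" "last ts = 1" and i: "Suc i < length ts" for ts :: "real list" and i
  proof (rule C_curve_iff[OF assms])
    have ne: "ts \<noteq> []" using i by auto
    have "sorted ts" using ts(1) by (rule strict_sorted_imp_sorted)
    \<comment> \<open>Sortedness places each subinterval between the first and last nodes, hence
      inside [0, 1], the only range on which \<open>lifts\<close> relates the curves.\<close>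
    then have "ts ! 0 \<le> ts ! i" "ts ! Suc i \<le> ts ! (length ts - 1)"
      using i by (auto intro!: sorted_nth_mono)
    then show "{ts ! i..ts ! Suc i} \<subseteq> {0..1}"
      using ts ne by (simp add: hd_conv_nth last_conv_nth)
  qed
  then show ?thesis
    unfolding piecewise_C_curve_def
    using lifts_continuous_on[OF assms] lifts_subset[OF assms] by (metis (no_types, lifting))
qed

text \<open>Composition with \<open>F\<close> and with \<open>G\<close> carries admissible curves to
  admissible curves of equal length. The two sets of lengths coincide, and so do their infima,
  including the empty case of distance \<open>\<infinity>\<close>.\<close>

lemma geodesic_dist_eq:
  assumes "p \<in> points N" "q \<in> points N"
  shows "geodesic_dist N p q = geodesic_dist M (F p) (F q)"
proof -
  let ?A = "{\<sigma>. piecewise_C_curve 1 N 0 1 \<sigma> \<and> \<sigma> 0 = p \<and> \<sigma> 1 = q}"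
  let ?B = "{\<tau>. piecewise_C_curve 1 M 0 1 \<tau> \<and> \<tau> 0 = F p \<and> \<tau> 1 = F q}"
  have "(\<lambda>\<sigma>. ennreal (curve_length N \<sigma>)) ` ?A = (\<lambda>\<tau>. ennreal (curve_length M \<tau>)) ` ?B"
  proof (intro set_eqI iffI)
    fix y assume "y \<in> (\<lambda>\<sigma>. ennreal (curve_length N \<sigma>)) ` ?A"
    then obtain \<sigma> where \<sigma>: "\<sigma> \<in> ?A" "y = ennreal (curve_length N \<sigma>)" by blast
    then have l: "lifts \<sigma> (F \<circ> \<sigma>)" by (intro lifts_push) (simp add: piecewise_C_curve_def)
    have "continuous_on {0..1} \<sigma>" using \<sigma>(1) by (simp add: piecewise_C_curve_def)
    then show "y \<in> (\<lambda>\<tau>. ennreal (curve_length M \<tau>)) ` ?B"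
      using \<sigma> piecewise_C_curve_iff[OF l] curve_length_eq[OF l]
      by (intro image_eqI[of _ _ "F \<circ> \<sigma>"]) auto
  next
    fix y assume "y \<in> (\<lambda>\<tau>. ennreal (curve_length M \<tau>)) ` ?B"
    then obtain \<tau> where \<tau>: "\<tau> \<in> ?B" "y = ennreal (curve_length M \<tau>)" by blast
    then have l: "lifts (G \<circ> \<tau>) \<tau>" by (intro lifts_pull) (simp add: piecewise_C_curve_def)
    have "continuous_on {0..1} (G \<circ> \<tau>)"
      using \<tau>(1) lifts_continuous_on[OF l] by (simp add: piecewise_C_curve_def)
    moreover have "G (F p) = p" "G (F q) = q"
      using assms homeo by (auto simp: homeomorphism_def)
    ultimately show "y \<in> (\<lambda>\<sigma>. ennreal (curve_length N \<sigma>)) ` ?A"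
      using \<tau> piecewise_C_curve_iff[OF l] curve_length_eq[OF l]
      by (intro image_eqI[of _ _ "G \<circ> \<tau>"]) auto
  qed
  then show ?thesis unfolding geodesic_dist_def by simp
qed

lemma geodesic_diameter_eq:
  assumes "A \<subseteq> points N"
  shows "geodesic_diameter N A = geodesic_diameter M (F ` A)"
  unfolding geodesic_diameter_def image_image
  using assms geodesic_dist_eq by (intro SUP_cong refl) auto

lemma geodesic_arc_iff:
  assumes l: "lifts \<sigma> \<tau>"
  shows "geodesic_arc N \<sigma> \<longleftrightarrow> geodesic_arc M \<tau>"
proof -
  have "\<sigma> constant_on {0..1} \<longleftrightarrow> \<tau> constant_on {0..1}"
  proof -
    have "\<sigma> s = \<sigma> t \<longleftrightarrow> \<tau> s = \<tau> t" if "s \<in> {0..1}" "t \<in> {0..1}" for s t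
      using l that inj_on_points by (auto simp: lifts_def inj_on_eq_iff)
    then have "(\<forall>s\<in>{0..1}. \<sigma> s = \<sigma> 0) \<longleftrightarrow> (\<forall>s\<in>{0..1}. \<tau> s = \<tau> 0)" by auto
    then show ?thesis
      by (simp only: constant_on_iff[of 0 "{0..1}"] atLeastAtMost_iff order_refl zero_le_one simp_thms)
  qed
  moreover have "(\<forall>c\<in>charts N. \<exists>x' x''. \<forall>t\<in>{t\<in>{0..1}. \<sigma> t \<in> fst c}.
        (snd c \<circ> \<sigma> has_vector_derivative x' t) (at t within {t\<in>{0..1}. \<sigma> t \<in> fst c}) \<and>
        (x' has_vector_derivative x'' t) (at t within {t\<in>{0..1}. \<sigma> t \<in> fst c}) \<and>
        (\<forall>w. metric N c (snd c (\<sigma> t)) (x'' t) w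
              + christoffel N c (snd c (\<sigma> t)) (x' t) (x' t) w = 0)) \<longleftrightarrow>
      (\<forall>d\<in>charts M. \<exists>x' x''. \<forall>t\<in>{t\<in>{0..1}. \<tau> t \<in> fst d}.
        (snd d \<circ> \<tau> has_vector_derivative x' t) (at t within {t\<in>{0..1}. \<tau> t \<in> fst d}) \<and>
        (x' has_vector_derivative x'' t) (at t within {t\<in>{0..1}. \<tau> t \<in> fst d}) \<and>
        (\<forall>w. metric M d (snd d (\<tau> t)) (x'' t) w
              + christoffel M d (snd d (\<tau> t)) (x' t) (x' t) w = 0))"
  proof (rule all_charts_iff)
    fix c d assume cd: "corresponding c d"
    let ?T = "{t\<in>{0..1}. \<sigma> t \<in> fst c}"
    have T: "{t\<in>{0..1}. \<tau> t \<in> fst d} = ?T" by (rule lifts_preimage[OF l cd order_refl])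
    have x: "snd d (\<tau> t) = snd c (\<sigma> t)" if "t \<in> ?T" for t
      using lifts_coordinates[OF l cd] that by simp
    have m: "metric M d (snd c (\<sigma> t)) = metric N c (snd c (\<sigma> t))"
      "christoffel M d (snd c (\<sigma> t)) = christoffel N c (snd c (\<sigma> t))" if "t \<in> ?T" for t
      using that metric_eq[OF cd] christoffel_eq[OF cd] by auto
    have "(snd c \<circ> \<sigma> has_vector_derivative D) (at t within ?T) \<longleftrightarrow>
        (snd d \<circ> \<tau> has_vector_derivative D) (at t within ?T)" if "t \<in> ?T" for t D
      by (rule has_vector_derivative_within_cong[OF that]) (simp add: x)
    then show "(\<exists>x' x''. \<forall>t\<in>?T.
        (snd c \<circ> \<sigma> has_vector_derivative x' t) (at t within ?T) \<and>
        (x' has_vector_derivative x'' t) (at t within ?T) \<and>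
        (\<forall>w. metric N c (snd c (\<sigma> t)) (x'' t) w
              + christoffel N c (snd c (\<sigma> t)) (x' t) (x' t) w = 0)) \<longleftrightarrow>
      (\<exists>x' x''. \<forall>t\<in>{t\<in>{0..1}. \<tau> t \<in> fst d}.
        (snd d \<circ> \<tau> has_vector_derivative x' t) (at t within {t\<in>{0..1}. \<tau> t \<in> fst d}) \<and>
        (x' has_vector_derivative x'' t) (at t within {t\<in>{0..1}. \<tau> t \<in> fst d}) \<and>
        (\<forall>w. metric M d (snd d (\<tau> t)) (x'' t) w
              + christoffel M d (snd d (\<tau> t)) (x' t) (x' t) w = 0))"
      \<comment> \<open>The same x' and x'' serve on both sides: parameter set, coordinate curve,
        metric and Christoffel symbols all agree.\<close>
      unfolding T by (simp add: x m cong: ball_cong)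
  qed
  ultimately show ?thesis
    using lifts_continuous_on[OF l] lifts_subset[OF l]
    unfolding geodesic_arc_def path_def path_image_def by blast
qed

lemma minimizing_geodesic_iff:
  assumes "lifts \<sigma> \<tau>"
  shows "minimizing_geodesic N \<sigma> \<longleftrightarrow> minimizing_geodesic M \<tau>"
\<comment> \<open>Equality of lengths requires a continuous curve, which a geodesic arc is; if
  \<open>\<sigma>\<close> is not a geodesic arc, both sides are false.\<close>
proof (cases "geodesic_arc N \<sigma>")
  case True
  then have "continuous_on {0..1} \<sigma>" by (simp add: geodesic_arc_def path_def)
  moreover have "geodesic_dist N (\<sigma> 0) (\<sigma> 1) = geodesic_dist M (\<tau> 0) (\<tau> 1)"
    using assms geodesic_dist_eq by (simp add: lifts_def)
  ultimately show ?thesis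
    unfolding minimizing_geodesic_def
    using geodesic_arc_iff[OF assms] curve_length_eq[OF assms] by simp
next
  case False
  then show ?thesis
    unfolding minimizing_geodesic_def using geodesic_arc_iff[OF assms] by simp
qed

section \<open>Polygonals, inscription and modulus\<close>

lemma lifts_endpoints_iff:
  assumes "lifts \<sigma> \<tau>" "t \<in> {0..1}" "p \<in> points N"
  shows "\<tau> t = F p \<longleftrightarrow> \<sigma> t = p"
  using assms inj_on_points by (auto simp: lifts_def inj_on_eq_iff)

lemma polygonal_iff:
  assumes "list_all2 lifts P Q"
  shows "polygonal N P \<longleftrightarrow> polygonal M Q"
proof -
  have len: "length Q = length P" using assms list_all2_lengthD by fastforce
  have l: "lifts (P ! i) (Q ! i)" if "i < length P" for i
    using assms that by (simp add: list_all2_nthD)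
  have "(\<forall>\<sigma>\<in>set P. geodesic_arc N \<sigma>) \<longleftrightarrow> (\<forall>\<tau>\<in>set Q. geodesic_arc M \<tau>)"
    unfolding all_set_conv_all_nth len using geodesic_arc_iff[OF l] by auto
  moreover have "(P ! i) 1 = (P ! Suc i) 0 \<longleftrightarrow> (Q ! i) 1 = (Q ! Suc i) 0" if "Suc i < length P" for i
    using l[of i] l[OF that] that inj_on_points by (auto simp: lifts_def inj_on_eq_iff)
  moreover have "P \<noteq> [] \<longleftrightarrow> Q \<noteq> []" using len by auto
  ultimately show ?thesis unfolding polygonal_def len by auto
qed

lemma rotation_eq:
  assumes "list_all2 lifts P Q" "polygonal N P"
  shows "rotation N P = rotation M Q"
proof -
  have len: "length Q = length P" using assms list_all2_lengthD by fastforce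
  have l: "lifts (P ! i) (Q ! i)" if "i < length P" for i
    using assms that by (simp add: list_all2_nthD)
  have c: "continuous_on {0..1} (P ! i)" if "i < length P" for i
    using assms(2) that by (auto simp: polygonal_def geodesic_arc_def path_def)
  show ?thesis
    unfolding rotation_def len
    using assms(2) by (intro sum.cong refl turning_angle_eq l c) (auto simp: polygonal_def)
qed

lemma inscribed_iff:
  assumes P: "list_all2 lifts P Q" and \<gamma>: "\<gamma> ` {a..b} \<subseteq> points N"
  shows "inscribed N a b \<gamma> ts P \<longleftrightarrow> inscribed M a b (F \<circ> \<gamma>) ts Q"
proof -
  have len: "length Q = length P" using P list_all2_lengthD by fastforce
  have "minimizing_geodesic N (P ! i) \<and> (P ! i) 0 = \<gamma> (ts ! i) \<and> (P ! i) 1 = \<gamma> (ts ! Suc i) \<longleftrightarrow>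
      minimizing_geodesic M (Q ! i) \<and> (Q ! i) 0 = (F \<circ> \<gamma>) (ts ! i) \<and> (Q ! i) 1 = (F \<circ> \<gamma>) (ts ! Suc i)"
    if "i < length P" "set ts \<subseteq> {a..b}" "length ts = Suc (length P)" for i
  proof -
    have l: "lifts (P ! i) (Q ! i)" using P that(1) by (simp add: list_all2_nthD)
    \<comment> \<open>There is one more parameter than arcs, so \<open>Suc i\<close> is still a
      valid index of \<open>ts\<close>.\<close>
    have "ts ! i \<in> {a..b}" "ts ! Suc i \<in> {a..b}"
      using that(1,3) by (simp_all only: subsetD[OF that(2) nth_mem] less_SucI Suc_less_eq)
    then have "\<gamma> (ts ! i) \<in> points N" "\<gamma> (ts ! Suc i) \<in> points N" using \<gamma> by auto
    then show ?thesis
      using minimizing_geodesic_iff[OF l] lifts_endpoints_iff[OF l] by simp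
  qed
  then show ?thesis
    unfolding inscribed_def len polygonal_iff[OF P] by blast
qed

lemma modulus_eq:
  assumes "set ts \<subseteq> {a..b}" "\<gamma> ` {a..b} \<subseteq> points N"
  shows "modulus N \<gamma> ts = modulus M (F \<circ> \<gamma>) ts"
proof -
  have "geodesic_diameter N (\<gamma> ` {ts ! i..ts ! Suc i}) =
      geodesic_diameter M ((F \<circ> \<gamma>) ` {ts ! i..ts ! Suc i})" if "i < length ts - 1" for i
  proof -
    have "ts ! i \<in> {a..b}" "ts ! Suc i \<in> {a..b}"
      by (rule subsetD[OF assms(1) nth_mem]; use that in simp)+
    then have "\<gamma> ` {ts ! i..ts ! Suc i} \<subseteq> points N"
      using assms(2) by (auto simp: image_subset_iff)
    then show ?thesis by (simp add: geodesic_diameter_eq image_comp)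
  qed
  then show ?thesis unfolding modulus_def by (intro arg_cong[of _ _ Max] image_cong) auto
qed

text \<open>Inscribed polygonals are transported arc by arc, with the same parameters, modulus and
  rotation. For each bound the two sets of rotations are therefore equal, so the suprema and their
  limits are the same expressions. Nonuniqueness of minimizing geodesics is harmless, since every
  choice of arcs is carried along in both directions.\<close>

theorem total_intrinsic_curvature_eq:
  assumes \<gamma>: "\<gamma> ` {a..b} \<subseteq> points N"
  shows "total_intrinsic_curvature N a b \<gamma> = total_intrinsic_curvature M a b (F \<circ> \<gamma>)"
proof -
  have "{ennreal (rotation N P) | ts P. inscribed N a b \<gamma> ts P \<and> modulus N \<gamma> ts < e} =
      {ennreal (rotation M Q) | ts Q.
        inscribed M a b (F \<circ> \<gamma>) ts Q \<and> modulus M (F \<circ> \<gamma>) ts < e}" (is "?A = ?B") for e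
  proof (intro set_eqI iffI)
    fix y assume "y \<in> ?A"
    then obtain ts P where P: "inscribed N a b \<gamma> ts P" "modulus N \<gamma> ts < e"
        "y = ennreal (rotation N P)" by blast
    then have poly: "polygonal N P" and ts: "set ts \<subseteq> {a..b}" by (auto simp: inscribed_def)
    have l: "list_all2 lifts P (map ((\<circ>) F) P)"
      using poly lifts_push
      by (auto simp: list_all2_conv_all_nth polygonal_def geodesic_arc_def path_image_def)
    have "inscribed M a b (F \<circ> \<gamma>) ts (map ((\<circ>) F) P)"
      using P(1) by (simp only: inscribed_iff[OF l \<gamma>])
    moreover have "modulus M (F \<circ> \<gamma>) ts < e" using P(2) by (simp only: modulus_eq[OF ts \<gamma>])
    moreover have "y = ennreal (rotation M (map ((\<circ>) F) P))"
      using P(3) by (simp only: rotation_eq[OF l poly])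
    ultimately show "y \<in> ?B" by blast
  next
    fix y assume "y \<in> ?B"
    then obtain ts Q where Q: "inscribed M a b (F \<circ> \<gamma>) ts Q" "modulus M (F \<circ> \<gamma>) ts < e"
        "y = ennreal (rotation M Q)" by blast
    then have poly: "polygonal M Q" and ts: "set ts \<subseteq> {a..b}" by (auto simp: inscribed_def)
    have l: "list_all2 lifts (map ((\<circ>) G) Q) Q"
      using poly lifts_pull
      by (auto simp: list_all2_conv_all_nth polygonal_def geodesic_arc_def path_image_def)
    have poly': "polygonal N (map ((\<circ>) G) Q)"
      using poly by (simp only: polygonal_iff[OF l])
    have "inscribed N a b \<gamma> ts (map ((\<circ>) G) Q)"
      using Q(1) by (simp only: inscribed_iff[OF l \<gamma>])
    moreover have "modulus N \<gamma> ts < e" using Q(2) by (simp only: modulus_eq[OF ts \<gamma>])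
    moreover have "y = ennreal (rotation N (map ((\<circ>) G) Q))"
      using Q(3) by (simp only: rotation_eq[OF l poly'])
    ultimately show "y \<in> ?A" by blast
  qed
  then show ?thesis unfolding total_intrinsic_curvature_def by simp
qed

end

section \<open>Charts of the embedded surface\<close>

lemma chart_on_subset: "chart_on S c \<Longrightarrow> fst c \<subseteq> S"
  unfolding chart_on_def using openin_imp_subset by blast

text \<open>Purely topological and stated for any homeomorphism, so that it serves both to push
  charts forward along \<open>F\<close> and to pull them back along \<open>G\<close>.\<close>

lemma chart_on_image:
  assumes ST: "homeomorphism S T F G" and c: "chart_on S c"
    and d: "fst d = F ` fst c" "\<forall>p\<in>fst c. snd d (F p) = snd c p"
  shows "chart_on T d" and "snd d ` fst d = snd c ` fst c"
    and "\<And>x. x \<in> snd c ` fst c \<Longrightarrow> chart_inv d x = F (chart_inv c x)"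
proof -
  let ?V = "snd c ` fst c"
  have cU: "openin (top_of_set S) (fst c)" and cV: "open ?V"
    and h: "homeomorphism (fst c) ?V (snd c) (chart_inv c)"
    using c by (auto simp: chart_on_def)
  have sub: "fst c \<subseteq> S" using c by (rule chart_on_subset)
  show V: "snd d ` fst d = ?V" unfolding d(1) image_image using d(2) by (intro image_cong) auto
  have GF: "G (F p) = p" if "p \<in> fst c" for p
    using ST sub that by (auto simp: homeomorphism_def)
  have FG: "homeomorphism (fst c) (F ` fst c) F G"
    using homeomorphism_of_subsets[OF ST sub _ refl] homeomorphism_image1[OF ST] sub by blast
  have "homeomorphism (F ` fst c) ?V (snd c \<circ> G) (F \<circ> chart_inv c)"
    using homeomorphism_compose[OF homeomorphism_symD[OF FG] h] .
  then have hd: "homeomorphism (fst d) ?V (snd d) (F \<circ> chart_inv c)"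
    by (rule homeomorphism_cong) (use d GF in auto)
  then have inj: "inj_on (snd d) (fst d)"
    by (intro inj_on_inverseI[where g = "F \<circ> chart_inv c"]) (simp add: homeomorphism_def)
  show inv: "chart_inv d x = F (chart_inv c x)" if "x \<in> ?V" for x
    unfolding chart_inv_def[of d]
    using hd that by (intro inv_into_f_eq[OF inj]) (auto simp: homeomorphism_def)
  have "homeomorphism (fst d) ?V (snd d) (chart_inv d)"
    using hd by (rule homeomorphism_cong) (use inv in auto)
  moreover have "openin (top_of_set T) (fst d)"
    unfolding d(1) using ST cU by (rule homeomorphism_imp_open_map)
  ultimately show "chart_on T d" using cV V by (simp add: chart_on_def)
qed

text \<open>On the overlap the transition map followed by the parametrization
  \<open>F \<circ> chart_inv d\<close> is \<open>F \<circ> chart_inv c\<close>. It is thus a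
  continuous lift through an immersion, and \<open>C_class_lift\<close> gives its regularity. The
  charts need not be known to belong to a common atlas.\<close>

lemma C_on_transition:
  fixes F :: "'a::topological_space \<Rightarrow> 'b::real_inner"
  assumes c: "chart_on S c" "C_on k (snd c ` fst c) (F \<circ> chart_inv c)"
    and d: "chart_on S d" "C_on k (snd d ` fst d) (F \<circ> chart_inv d)"
    and inj: "\<And>x. x \<in> snd d ` fst d \<Longrightarrow> inj (frechet_derivative (F \<circ> chart_inv d) (at x))"
  shows "C_on k (snd c ` (fst c \<inter> fst d)) (transition c d)"
  unfolding C_on_def
proof (intro allI impI)
  fix n assume n: "enat n \<le> k"
  let ?W = "snd c ` (fst c \<inter> fst d)"
  have hc: "homeomorphism (fst c) (snd c ` fst c) (snd c) (chart_inv c)"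
    and hd: "homeomorphism (fst d) (snd d ` fst d) (snd d) (chart_inv d)"
    and o: "open (snd d ` fst d)"
    using c d by (auto simp: chart_on_def)
  have cc: "chart_inv c (snd c p) = p" if "p \<in> fst c" for p
    using hc that by (auto simp: homeomorphism_def)
  have dd: "chart_inv d (snd d p) = p" if "p \<in> fst d" for p
    using hd that by (auto simp: homeomorphism_def)
  have "continuous_on ?W (chart_inv c)"
    using homeomorphism_cont2[OF hc] by (rule continuous_on_subset) auto
  moreover have "chart_inv c ` ?W \<subseteq> fst d" using cc by auto
  ultimately have cont: "continuous_on ?W (transition c d)"
    unfolding transition_def
    using homeomorphism_cont1[OF hd] by (blast intro: continuous_on_compose continuous_on_subset)
  show "C_class n ?W (transition c d)"
  proof (rule C_class_lift[OF o _ cont inj])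
    show "C_class n ?W (F \<circ> chart_inv c)"
      using c(2) n by (auto simp: C_on_def intro: C_class_subset)
    show "C_class n (snd d ` fst d) (F \<circ> chart_inv d)"
      using d(2) n by (auto simp: C_on_def)
  qed (auto simp: transition_def cc dd)
qed

lemma isometric_embedding_surface_isometry:
  assumes N: "riemannian_surface k N" and F: "isometric_embedding k N F"
  obtains G where "surface_isometry N (embedded_surface k (F ` points N)) F G"
proof -
  let ?M = "embedded_surface k (F ` points N)"
  obtain G where G: "homeomorphism (points N) (F ` points N) F G"
    using F by (auto simp: isometric_embedding_def)
  have FG: "F (G q) = q" if "q \<in> F ` points N" for q
    using G that by (auto simp: homeomorphism_def)
  have GF: "G (F p) = p" if "p \<in> points N" for p
    using G that by (auto simp: homeomorphism_def)
  have atlas: "maximal_atlas k (points N) (charts N)"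
    using N by (simp add: riemannian_surface_def)
  have chart: "chart_on (points N) c" if "c \<in> charts N" for c
    using atlas that unfolding maximal_atlas_def by blast
  have sub: "fst c \<subseteq> points N" if "c \<in> charts N" for c
    using chart[OF that] by (rule chart_on_subset)
  have smooth: "C_on k (snd c ` fst c) (F \<circ> chart_inv c)"
    and immersion: "\<And>x. x \<in> snd c ` fst c \<Longrightarrow> inj (frechet_derivative (F \<circ> chart_inv c) (at x))"
    and isometry: "\<And>x u v. x \<in> snd c ` fst c \<Longrightarrow>
      frechet_derivative (F \<circ> chart_inv c) (at x) u \<bullet> frechet_derivative (F \<circ> chart_inv c) (at x) v
      = metric N c x u v" if "c \<in> charts N" for c
    using F that by (auto simp: isometric_embedding_def)
  have "surface_isometry N ?M F G"
  proof
    show "homeomorphism (points N) (points ?M) F G"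
      using G by (simp add: embedded_surface_def)
    show "chart_on (points N) c" if "c \<in> charts N" for c
      using that by (rule chart)
    \<comment> \<open>Near x the parametrization by d is \<open>F\<close> after that by c, so the
      first fundamental form is the metric of \<open>N\<close> by isometry. Pushing and pulling then
      only require a partner chart that lies in the atlas.\<close>
    have corr: "corresponding_charts N ?M F c d"
      if c: "c \<in> charts N" and d: "d \<in> charts ?M"
        and cd: "fst d = F ` fst c" "\<forall>p\<in>fst c. snd d (F p) = snd c p" for c d
    proof -
      note img = chart_on_image[OF G chart[OF c] cd]
      have "metric N c x = metric ?M d x" if x: "x \<in> snd c ` fst c" for x
      proof -
        have "frechet_derivative (chart_inv d) (at x) = frechet_derivative (F \<circ> chart_inv c) (at x)"
          using chart[OF c] x img(3) by (intro frechet_derivative_cong_open) (auto simp: chart_on_def)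
        then show ?thesis
          using isometry[OF c x] by (auto simp: embedded_surface_def fun_eq_iff)
      qed
      with c d cd show ?thesis by (simp add: corresponding_charts_def)
    qed
    show "\<exists>d. corresponding_charts N ?M F c d" if c: "c \<in> charts N" for c
    proof -
      define d where "d = (F ` fst c, snd c \<circ> G)"
      have cd: "fst d = F ` fst c" "\<forall>p\<in>fst c. snd d (F p) = snd c p"
        using GF sub[OF c] by (auto simp: d_def)
      note img = chart_on_image[OF G chart[OF c] cd]
      have "C_on k (snd d ` fst d) (chart_inv d)"
        unfolding img(2) using smooth[OF c] by (rule C_on_cong) (simp add: img(3))
      moreover have "inj (frechet_derivative (chart_inv d) (at x))" if x: "x \<in> snd d ` fst d" for x
      proof -
        have x': "x \<in> snd c ` fst c" using x unfolding img(2) .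
        have "frechet_derivative (chart_inv d) (at x) = frechet_derivative (F \<circ> chart_inv c) (at x)"
          using chart[OF c] x' img(3) by (intro frechet_derivative_cong_open) (auto simp: chart_on_def)
        with immersion[OF c x'] show ?thesis by simp
      qed
      ultimately have "d \<in> charts ?M"
        using img(1) unfolding embedded_surface_def by simp
      from corr[OF c this cd] show ?thesis by blast
    qed
    show "\<exists>c. corresponding_charts N ?M F c d" if d: "d \<in> charts ?M" for d
    proof -
      have d_on: "chart_on (F ` points N) d"
        and d_smooth: "C_on k (snd d ` fst d) (chart_inv d)"
        and d_inj: "\<And>x. x \<in> snd d ` fst d \<Longrightarrow> inj (frechet_derivative (chart_inv d) (at x))"
        using d by (auto simp: embedded_surface_def)
      have d_sub: "fst d \<subseteq> F ` points N"
        using d_on by (rule chart_on_subset)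
      define c where "c = (G ` fst d, snd d \<circ> F)"
      have dc: "fst c = G ` fst d" "\<forall>q\<in>fst d. snd c (G q) = snd d q"
        using FG d_sub by (auto simp: c_def)
      \<comment> \<open>The roles of \<open>F\<close> and \<open>G\<close> are exchanged
        here.\<close>
      note img = chart_on_image[OF homeomorphism_symD[OF G] d_on dc]
      have inv: "(F \<circ> chart_inv c) x = chart_inv d x" if x: "x \<in> snd d ` fst d" for x
      proof -
        have "chart_inv d x \<in> fst d"
          using d_on x by (auto simp: chart_on_def homeomorphism_def)
        then show ?thesis using img(3)[OF x] FG d_sub by auto
      qed
      have c_smooth: "C_on k (snd c ` fst c) (F \<circ> chart_inv c)"
        unfolding img(2) using d_smooth inv by (rule C_on_cong)
      have c_inj: "inj (frechet_derivative (F \<circ> chart_inv c) (at x))"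
        if x: "x \<in> snd c ` fst c" for x
      proof -
        have x': "x \<in> snd d ` fst d" using x unfolding img(2) .
        have "open (snd d ` fst d)" using d_on by (simp add: chart_on_def)
        then have "frechet_derivative (F \<circ> chart_inv c) (at x) = frechet_derivative (chart_inv d) (at x)"
          using x' inv by (rule frechet_derivative_cong_open)
        with d_inj[OF x'] show ?thesis by simp
      qed
      \<comment> \<open>Both c and e become immersions of class C^k after composition with
        \<open>F\<close>, so the lifting result applies in both directions.\<close>
      have "compatible k c e" if e: "e \<in> charts N" for e
        unfolding compatible_def
      proof
        show "C_on k (snd c ` (fst c \<inter> fst e)) (transition c e)"
          using img(1) c_smooth chart[OF e] smooth[OF e] immersion[OF e] by (rule C_on_transition)
        show "C_on k (snd e ` (fst c \<inter> fst e)) (transition e c)"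
          unfolding Int_commute[of "fst c"]
          using chart[OF e] smooth[OF e] img(1) c_smooth c_inj by (rule C_on_transition)
      qed
      \<comment> \<open>Maximality of the atlas turns compatibility with all its charts into
        membership.\<close>
      with atlas img(1) have "c \<in> charts N" unfolding maximal_atlas_def by blast
      moreover have "fst d = F ` fst c" using FG d_sub by (force simp: c_def image_image)
      moreover have "\<forall>p\<in>fst c. snd d (F p) = snd c p" by (simp add: c_def)
      ultimately show ?thesis using corr[OF _ d] by blast
    qed
  qed
  then show thesis by (rule that)
qed

text \<open>Independence of the embedding is contained in the equation, because its left-hand side
  does not mention \<open>F\<close>.\<close>

theorem proposition7p2:
  fixes N :: "'a::t2_space surface"
    and F :: "'a \<Rightarrow> real ^ 'n"
    and \<gamma> :: "real \<Rightarrow> 'a"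
    and a b :: real
    and k r :: enat
  assumes "3 \<le> k"
    and "riemannian_surface k N"
    and "compact (points N)"
    and "1 \<le> r" and "r \<le> k"
    and "piecewise_C_curve r N a b \<gamma>"
    and "isometric_embedding k N F"
  shows "total_intrinsic_curvature N a b \<gamma> =
         total_intrinsic_curvature (embedded_surface k (F ` points N)) a b (F \<circ> \<gamma>)"
proof -
  obtain G where "surface_isometry N (embedded_surface k (F ` points N)) F G"
    using assms(2,7) by (rule isometric_embedding_surface_isometry)
  then interpret surface_isometry N "embedded_surface k (F ` points N)" F G .
  show ?thesis
    using assms(6) by (intro total_intrinsic_curvature_eq) (simp add: piecewise_C_curve_def)
qed

end
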